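(* Any linear system of two second-order ODEs of the form $$y''=\alpha_3(t)y-\alpha_4(t)z,\qquad z''=\alpha_4(t)y+\alpha_3(t)z$$ with two arbitrary coefficients $\alpha_3,\alpha_4$ is transformable to a simplest system of two linear ODEs $$Y''=-\beta(x)Z,\qquad Z''=\beta(x)Y$$ with one arbitrary coefficient $\beta$, via the real point transformations $$Y=\frac{y}{\rho(t)},\qquad Z=\frac{z}{\rho(t)},\qquad x=\int^{t}\rho^{-2}(s)\,ds,$$ where $\rho$ satisfies $$\rho''-\alpha_3\rho=0.$$
   Context: $\alpha_3,\alpha_4$ are real functions of a real independent variable $t$, and $y,z$ are real dependent variables. In the first system and in the equation for $\rho$, prime denotes $d/dt$; in the system for $Y,Z$, prime denotes $d/dx$, and $\beta$ is a real function of $x$. The transformation is understood locally, on an interval where the solution $\rho$ does not vanish. *)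

theory Defs
  imports "HOL-Analysis.Analysis"
begin

definition open_interval :: "real set \<Rightarrow> bool" where
  "open_interval J \<longleftrightarrow> open J \<and> is_interval J \<and> J \<noteq> {}"

text \<open>\<open>has_second_deriv_on u w J\<close>: on the (open) set \<open>J\<close> the function \<open>u\<close> is twice
  differentiable and \<open>u'' = w\<close>.\<close>

definition has_second_deriv_on ::
    "(real \<Rightarrow> real) \<Rightarrow> (real \<Rightarrow> real) \<Rightarrow> real set \<Rightarrow> bool" where
  "has_second_deriv_on u w J \<longleftrightarrow>
     (\<exists>u'. \<forall>t\<in>J. (u has_real_derivative u' t) (at t) \<and> (u' has_real_derivative w t) (at t))"

text \<open>A pair of right-hand sides \<open>f, g\<close> stands for the system
  \<open>y'' = f(t, y, z), z'' = g(t, y, z)\<close>.\<close>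

definition solution_on ::
    "(real \<Rightarrow> real \<Rightarrow> real \<Rightarrow> real) \<Rightarrow> (real \<Rightarrow> real \<Rightarrow> real \<Rightarrow> real) \<Rightarrow>
     real set \<Rightarrow> (real \<Rightarrow> real) \<Rightarrow> (real \<Rightarrow> real) \<Rightarrow> bool" where
  "solution_on f g J y z \<longleftrightarrow>
     has_second_deriv_on y (\<lambda>t. f t (y t) (z t)) J \<and>
     has_second_deriv_on z (\<lambda>t. g t (y t) (z t)) J"

definition curve ::
    "real set \<Rightarrow> (real \<Rightarrow> real) \<Rightarrow> (real \<Rightarrow> real) \<Rightarrow> (real \<times> real \<times> real) set" where
  "curve J y z = (\<lambda>t. (t, y t, z t)) ` J"

text \<open>An invertible change of independent and dependent variables
  \<open>(t, y, z) \<mapsto> (x, Y, Z)\<close>, differentiable in both directions.\<close>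

definition point_transformation ::
    "(real \<times> real \<times> real \<Rightarrow> real \<times> real \<times> real) \<Rightarrow> real set \<Rightarrow> real set \<Rightarrow> bool" where
  "point_transformation \<Phi> J J' \<longleftrightarrow>
     open_interval J \<and> open_interval J' \<and>
     bij_betw \<Phi> (J \<times> UNIV) (J' \<times> UNIV) \<and>
     \<Phi> differentiable_on (J \<times> UNIV) \<and>
     inv_into (J \<times> UNIV) \<Phi> differentiable_on (J' \<times> UNIV)"

text \<open>The point transformation maps the solution curves of the first system onto those of the
  second. Solutions over all open subintervals are considered: the coefficients need not be
  continuous, so a solution need not extend to the whole interval.\<close>

definition transforms_system ::
    "(real \<times> real \<times> real \<Rightarrow> real \<times> real \<times> real) \<Rightarrow>
     (real \<Rightarrow> real \<Rightarrow> real \<Rightarrow> real) \<Rightarrow> (real \<Rightarrow> real \<Rightarrow> real \<Rightarrow> real) \<Rightarrow> real set \<Rightarrow>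
     (real \<Rightarrow> real \<Rightarrow> real \<Rightarrow> real) \<Rightarrow> (real \<Rightarrow> real \<Rightarrow> real \<Rightarrow> real) \<Rightarrow> real set \<Rightarrow> bool" where
  "transforms_system \<Phi> f g J F G J' \<longleftrightarrow>
     point_transformation \<Phi> J J' \<and>
     (\<forall>K y z. open_interval K \<and> K \<subseteq> J \<and> solution_on f g K y z \<longrightarrow>
        (\<exists>K' Y Z. open_interval K' \<and> K' \<subseteq> J' \<and> solution_on F G K' Y Z \<and>
           \<Phi> ` curve K y z = curve K' Y Z)) \<and>
     (\<forall>K' Y Z. open_interval K' \<and> K' \<subseteq> J' \<and> solution_on F G K' Y Z \<longrightarrow>
        (\<exists>K y z. open_interval K \<and> K \<subseteq> J \<and> solution_on f g K y z \<and>
           \<Phi> ` curve K y z = curve K' Y Z))"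

text \<open>The integral without lower limit is determined up to the choice of a base point and an
  additive constant.\<close>

definition indefinite_integral_on :: "(real \<Rightarrow> real) \<Rightarrow> (real \<Rightarrow> real) \<Rightarrow> real set \<Rightarrow> bool" where
  "indefinite_integral_on f F J \<longleftrightarrow>
     (\<exists>a\<in>J. \<exists>c. \<forall>t\<in>J. F t = c + (LBINT s=ereal a..ereal t. f s))"

text \<open>The data of the transformation: a nonvanishing solution \<open>\<rho>\<close> of
  \<open>\<rho>'' - \<alpha>\<^sub>3 \<rho> = 0\<close> on \<open>J\<close> and the new independent variable \<open>x\<close>.\<close>

definition reduction_data ::
    "(real \<Rightarrow> real) \<Rightarrow> real set \<Rightarrow> (real \<Rightarrow> real) \<Rightarrow> (real \<Rightarrow> real) \<Rightarrow> bool" where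
  "reduction_data \<alpha>\<^sub>3 J \<rho> x \<longleftrightarrow>
     open_interval J \<and>
     (\<exists>\<rho>''. has_second_deriv_on \<rho> \<rho>'' J \<and> (\<forall>t\<in>J. \<rho>'' t - \<alpha>\<^sub>3 t * \<rho> t = 0)) \<and>
     (\<forall>t\<in>J. \<rho> t \<noteq> 0) \<and>
     indefinite_integral_on (\<lambda>s. 1 / (\<rho> s)\<^sup>2) x J"

end

theory Submission imports Defs begin

text \<open>
  Both components of the system are treated alike, because the change of variables acts on each of
  them separately. Put \<open>Y = y / \<rho>\<close> with \<open>dx/dt = 1 / \<rho>\<^sup>2\<close>. Then
  \<open>dY/dx = \<rho>\<^sup>2 (y / \<rho>)' = y' \<rho> - y \<rho>'\<close> is the Wronskian of \<open>y\<close> and \<open>\<rho>\<close>: the weight in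
  \<open>dx\<close> is chosen to cancel the denominator. Differentiating once more, the products of first
  derivatives cancel, and with \<open>\<rho>'' = \<alpha>\<^sub>3 \<rho>\<close> one gets
  \<open>d\<^sup>2Y/dx\<^sup>2 = \<rho>\<^sup>3 (y'' - \<alpha>\<^sub>3 y)\<close>. So the diagonal term of the system disappears, and the coupling
  term \<open>- \<alpha>\<^sub>4 z = - \<alpha>\<^sub>4 \<rho> Z\<close> becomes \<open>- \<rho>\<^sup>4 \<alpha>\<^sub>4 Z\<close>; the same holds for the other component. Hence
  \<open>\<beta> = \<rho>\<^sup>4 \<alpha>\<^sub>4\<close>, expressed in the variable \<open>x\<close>. The computation and its reverse are
  \<open>second_deriv_new_variables\<close> and \<open>second_deriv_old_variables\<close>. They translate solutions over any
  open subinterval because \<open>x\<close>, having positive derivative, is a diffeomorphism onto an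
  open interval.

  A suitable \<open>\<rho>\<close> exists near each point when \<open>\<alpha>\<^sub>3\<close> is continuous. Successive approximation from the
  constant \<open>1\<close> writes the solution with \<open>\<rho> = 1\<close> and \<open>\<rho>' = 0\<close> at the point as a series whose
  terms decay geometrically on a small interval. Since the corrections add up to at
  most \<open>1/3\<close>, the solution has no zero there (\<open>small_interval_nonvanishing_solution\<close>).
\<close>

section \<open>Primitives on open intervals\<close>

lemma open_interval_Icc_subset:
  assumes "open_interval J" "u \<in> J" "v \<in> J"
  shows "{u..v} \<subseteq> J"
  using assms mem_is_interval_1_I[of J u v] by (auto simp: open_interval_def)

text \<open>On a compact interval the fundamental theorem of calculus is only a one-sided statement at
  the end points. Enclosing \<open>a\<close> and a neighbourhood of \<open>t\<close> in one compact
  subinterval turns it into a two-sided derivative at \<open>t\<close>, on whichever side of \<open>a\<close> it lies.\<close>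

lemma interval_primitive_has_derivative:
  assumes J: "open_interval J" and f: "continuous_on J f" and a: "a \<in> J" and t: "t \<in> J"
  shows "((\<lambda>u. LBINT s=ereal a..ereal u. f s) has_real_derivative f t) (at t)"
proof -
  have "open J" using J by (simp add: open_interval_def)
  then obtain e where e: "e > 0" "cball t e \<subseteq> J"
    using t open_contains_cball by blast
  have te: "t - e \<in> J" "t + e \<in> J"
    using e by (auto simp: subset_iff dist_real_def)
  define p q where "p = min a (t - e)" and "q = max a (t + e)"
  have pq: "p \<in> J" "q \<in> J" using a te by (auto simp: p_def q_def min_def max_def)
  have sub: "{p..q} \<subseteq> J"
    using pq J by (simp add: open_interval_Icc_subset)
  have le: "p \<le> a" "a \<le> q" "p < t" "t < q" using e by (auto simp: p_def q_def)
  have "((\<lambda>u. LBINT s=a..u. f s) has_vector_derivative f t) (at t within {p..q})"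
    by (rule interval_integral_FTC2) (use le continuous_on_subset[OF f sub] in auto)
  moreover have "at t within {p..q} = at t"
    using le by (intro at_within_interior) auto
  ultimately show ?thesis by (simp add: has_real_derivative_iff_has_vector_derivative)
qed

lemma interval_primitive_bound:
  assumes J: "open_interval J" and f: "continuous_on J f" and a: "a \<in> J" and t: "t \<in> J"
    and bound: "\<And>s. s \<in> J \<Longrightarrow> \<bar>f s\<bar> \<le> B"
  shows "\<bar>LBINT s=ereal a..ereal t. f s\<bar> \<le> B * \<bar>t - a\<bar>"
proof -
  let ?F = "\<lambda>u. LBINT s=ereal a..ereal u. f s"
  have "convex J" using J by (simp add: open_interval_def is_interval_convex)
  then have "norm (?F t - ?F a) \<le> B * norm (t - a)"
    by (rule field_differentiable_bound[where f' = f])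
      (use assms in \<open>auto intro: has_field_derivative_at_within interval_primitive_has_derivative\<close>)
  then show ?thesis by simp
qed

section \<open>Auxiliary facts on intervals and differentiability\<close>

lemma open_interval_image:
  fixes f :: "real \<Rightarrow> real"
  assumes "open_interval K" "continuous_on K f" "inj_on f K"
  shows "open_interval (f ` K)"
  using assms invariance_of_domain[of K f] connected_continuous_image[of K f]
  by (simp add: open_interval_def is_interval_connected_1)

lemma differentiable_fst_comp:
  assumes "(f has_real_derivative d) (at (fst p))"
  shows "(\<lambda>p. f (fst p)) differentiable (at p within S)"
proof -
  have "f differentiable (at (fst p))"
    using assms real_differentiable_def by blast
  then have "(f \<circ> fst) differentiable (at p)"
    by (rule differentiable_chain_at[OF bounded_linear_imp_differentiable[OF bounded_linear_fst]])
  then show ?thesis by (simp add: o_def differentiable_at_withinI)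
qed

lemma Pair_differentiable:
  assumes "f differentiable (at p within S)" "g differentiable (at p within S)"
  shows "(\<lambda>p. (f p, g p)) differentiable (at p within S)"
  using assms unfolding differentiable_def by (elim exE) (rule exI, rule has_derivative_Pair)

lemma fst_snd_differentiable:
  fixes F :: "(real \<times> real \<times> real) filter"
  shows "(\<lambda>p. fst (snd p)) differentiable F" "(\<lambda>p. snd (snd p)) differentiable F"
  unfolding differentiable_def
  by (rule exI, rule bounded_linear_imp_has_derivative,
      rule bounded_linear_compose[OF bounded_linear_fst bounded_linear_snd])
    (rule exI, rule bounded_linear_imp_has_derivative,
      rule bounded_linear_compose[OF bounded_linear_snd bounded_linear_snd])

section \<open>Reduction of a linear system by a solution of the scalar equation\<close>

text \<open>The data of the transformation with differentiation in place of integration: the primitive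
  \<open>x\<close> is known only through its derivative, and \<open>q\<close> is the coefficient of the scalar equation
  \<open>\<rho>'' = q \<rho>\<close>.\<close>

locale liouville_change =
  fixes J :: "real set" and q \<rho> \<rho>' x :: "real \<Rightarrow> real"
  assumes J: "open_interval J"
    and rho_deriv: "\<And>t. t \<in> J \<Longrightarrow> (\<rho> has_real_derivative \<rho>' t) (at t)"
    and rho'_deriv: "\<And>t. t \<in> J \<Longrightarrow> (\<rho>' has_real_derivative q t * \<rho> t) (at t)"
    and rho_nz: "\<And>t. t \<in> J \<Longrightarrow> \<rho> t \<noteq> 0"
    and x_deriv: "\<And>t. t \<in> J \<Longrightarrow> (x has_real_derivative 1 / (\<rho> t)\<^sup>2) (at t)"
begin

definition \<tau> :: "real \<Rightarrow> real" where "\<tau> = inv_into J x"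

definition \<Phi> :: "real \<times> real \<times> real \<Rightarrow> real \<times> real \<times> real" where
  "\<Phi> = (\<lambda>(t, y, z). (x t, y / \<rho> t, z / \<rho> t))"

definition \<Psi> :: "real \<times> real \<times> real \<Rightarrow> real \<times> real \<times> real" where
  "\<Psi> = (\<lambda>(s, Y, Z). (\<tau> s, \<rho> (\<tau> s) * Y, \<rho> (\<tau> s) * Z))"

lemma x_inj: "inj_on x J"
proof (rule linorder_inj_onI)
  fix u v assume uv: "u < v" "u \<in> J" "v \<in> J"
  have "{u..v} \<subseteq> J" using J uv by (simp add: open_interval_Icc_subset)
  then have "\<exists>d. (x has_real_derivative d) (at w) \<and> d > 0" if "u \<le> w" "w \<le> v" for w
    using x_deriv[of w] rho_nz[of w] that by (intro exI[of _ "1 / (\<rho> w)\<^sup>2"]) auto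
  with uv(1) have "x u < x v" by (rule DERIV_pos_imp_increasing)
  then show "x u \<noteq> x v" by simp
qed auto

lemma tau_x [simp]: "t \<in> J \<Longrightarrow> \<tau> (x t) = t"
  by (simp add: \<tau>_def x_inj)

lemma tau_inj: "inj_on \<tau> (x ` J)"
  by (auto simp: inj_on_def)

lemma x_cont: "continuous_on J x"
  by (meson DERIV_isCont continuous_at_imp_continuous_on x_deriv)

text \<open>The inverse function theorem applies directly, since \<open>\<tau>\<close> is already known to be a left inverse of
  the continuous map \<open>x\<close> on an open set.\<close>

lemma tau_deriv:
  assumes t: "t \<in> J"
  shows "(\<tau> has_real_derivative (\<rho> t)\<^sup>2) (at (x t))"
  unfolding has_field_derivative_def
proof (rule has_derivative_inverse_strong[where S = J and f = x])
  show "(x has_derivative (*) (1 / (\<rho> t)\<^sup>2)) (at t)"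
    using x_deriv[OF t] by (simp add: has_field_derivative_def)
  show "(*) (1 / (\<rho> t)\<^sup>2) \<circ> (*) ((\<rho> t)\<^sup>2) = id"
    using rho_nz[OF t] by (auto simp: fun_eq_iff)
qed (use J t x_cont in \<open>auto simp: open_interval_def\<close>)

lemma tau_cont: "continuous_on (x ` J) \<tau>"
  by (rule continuous_at_imp_continuous_on) (auto dest: tau_deriv DERIV_isCont)

lemma Phi_has_inverse:
  shows "bij_betw \<Phi> (J \<times> UNIV) (x ` J \<times> UNIV)"
    and "\<And>p. p \<in> x ` J \<times> UNIV \<Longrightarrow> inv_into (J \<times> UNIV) \<Phi> p = \<Psi> p"
proof -
  show bij: "bij_betw \<Phi> (J \<times> UNIV) (x ` J \<times> UNIV)"
    by (rule bij_betw_byWitness[where f' = \<Psi>]) (auto simp: \<Phi>_def \<Psi>_def rho_nz)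
  show "inv_into (J \<times> UNIV) \<Phi> p = \<Psi> p" if "p \<in> x ` J \<times> UNIV" for p
    by (rule inv_into_f_eq[OF bij_betw_imp_inj_on[OF bij]])
      (use that in \<open>auto simp: \<Phi>_def \<Psi>_def rho_nz\<close>)
qed

lemma Phi_differentiable: "\<Phi> differentiable_on (J \<times> UNIV)"
  unfolding differentiable_on_def
proof
  fix p :: "real \<times> real \<times> real" assume "p \<in> J \<times> UNIV"
  then have p: "fst p \<in> J" by auto
  have "(\<lambda>p. (x (fst p), fst (snd p) / \<rho> (fst p), snd (snd p) / \<rho> (fst p)))
      differentiable (at p within J \<times> UNIV)"
    using p rho_nz
    by (intro Pair_differentiable differentiable_divide fst_snd_differentiable
        differentiable_fst_comp[OF x_deriv] differentiable_fst_comp[OF rho_deriv]) auto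
  then show "\<Phi> differentiable (at p within J \<times> UNIV)"
    by (simp add: \<Phi>_def case_prod_unfold)
qed

lemma Psi_differentiable: "\<Psi> differentiable_on (x ` J \<times> UNIV)"
  unfolding differentiable_on_def
proof
  fix p :: "real \<times> real \<times> real" assume "p \<in> x ` J \<times> UNIV"
  then obtain t where t: "t \<in> J" "fst p = x t" by auto
  have \<tau>: "(\<tau> has_real_derivative (\<rho> t)\<^sup>2) (at (fst p))"
    using tau_deriv t by simp
  have \<rho>\<tau>: "((\<lambda>s. \<rho> (\<tau> s)) has_real_derivative \<rho>' t * (\<rho> t)\<^sup>2) (at (fst p))"
    by (rule DERIV_chain2[OF _ \<tau>]) (use t rho_deriv in simp)
  have "(\<lambda>p. (\<tau> (fst p), \<rho> (\<tau> (fst p)) * fst (snd p), \<rho> (\<tau> (fst p)) * snd (snd p)))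
      differentiable (at p within x ` J \<times> UNIV)"
    by (intro Pair_differentiable differentiable_mult fst_snd_differentiable
        differentiable_fst_comp[OF \<tau>] differentiable_fst_comp[OF \<rho>\<tau>])
  then show "\<Psi> differentiable (at p within x ` J \<times> UNIV)"
    by (simp add: \<Psi>_def case_prod_unfold)
qed

lemma Phi_point_transformation: "point_transformation \<Phi> J (x ` J)"
proof -
  have "inv_into (J \<times> UNIV) \<Phi> differentiable_on (x ` J \<times> UNIV)"
    unfolding differentiable_on_def
  proof
    fix p :: "real \<times> real \<times> real" assume p: "p \<in> x ` J \<times> UNIV"
    show "inv_into (J \<times> UNIV) \<Phi> differentiable (at p within x ` J \<times> UNIV)"
      by (rule differentiable_transform_within[where f = \<Psi>, OF _ zero_less_one p])
        (use Psi_differentiable p Phi_has_inverse(2) in \<open>auto simp: differentiable_on_def\<close>)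
  qed
  then show ?thesis
    unfolding point_transformation_def
    using J open_interval_image[OF J x_cont x_inj] Phi_has_inverse(1) Phi_differentiable by blast
qed

text \<open>In the variable \<open>x\<close> the first derivative of \<open>y / \<rho>\<close> is the Wronskian \<open>y' \<rho> - y \<rho>'\<close>. Its
  \<open>t\<close>-derivative is \<open>y'' \<rho> - y \<rho>'' = \<rho> (y'' - q y)\<close>, and passing to \<open>x\<close> contributes another
  factor \<open>\<rho>\<^sup>2\<close>. The function \<open>W\<close> is prescribed only on the image of \<open>K\<close>, so that it can be the
  right-hand side of the reduced system.\<close>

lemma second_deriv_new_variables:
  assumes y: "has_second_deriv_on y w K" and K: "K \<subseteq> J"
    and W: "\<And>t. t \<in> K \<Longrightarrow> W (x t) = (\<rho> t)^3 * (w t - q t * y t)"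
  shows "has_second_deriv_on (\<lambda>s. y (\<tau> s) / \<rho> (\<tau> s)) W (x ` K)"
proof -
  obtain y' where y: "\<And>t. t \<in> K \<Longrightarrow> (y has_real_derivative y' t) (at t)"
    and y': "\<And>t. t \<in> K \<Longrightarrow> (y' has_real_derivative w t) (at t)"
    using y by (auto simp: has_second_deriv_on_def)
  let ?v = "\<lambda>t. y' t * \<rho> t - y t * \<rho>' t"
  have "((\<lambda>s. y (\<tau> s) / \<rho> (\<tau> s)) has_real_derivative ?v (\<tau> (x t))) (at (x t))"
    and "((\<lambda>s. ?v (\<tau> s)) has_real_derivative W (x t)) (at (x t))" if t: "t \<in> K" for t
  proof -
    have tJ: "t \<in> J" using t K by auto
    have "((\<lambda>t. y t / \<rho> t) has_real_derivative ?v t / (\<rho> t)\<^sup>2) (at t)"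
      using y[OF t] rho_deriv[OF tJ] rho_nz[OF tJ]
      by (auto intro!: derivative_eq_intros simp: power2_eq_square field_simps)
    then have "((\<lambda>s. y (\<tau> s) / \<rho> (\<tau> s)) has_real_derivative ?v t / (\<rho> t)\<^sup>2 * (\<rho> t)\<^sup>2) (at (x t))"
      by (intro DERIV_chain2[OF _ tau_deriv[OF tJ], where f = "\<lambda>t. y t / \<rho> t"]) (use tJ in simp)
    then show "((\<lambda>s. y (\<tau> s) / \<rho> (\<tau> s)) has_real_derivative ?v (\<tau> (x t))) (at (x t))"
      using tJ rho_nz by simp
    have "(?v has_real_derivative \<rho> t * (w t - q t * y t)) (at t)"
      using y[OF t] y'[OF t] rho_deriv[OF tJ] rho'_deriv[OF tJ]
      by (auto intro!: derivative_eq_intros simp: algebra_simps)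
    then have "((\<lambda>s. ?v (\<tau> s)) has_real_derivative \<rho> t * (w t - q t * y t) * (\<rho> t)\<^sup>2) (at (x t))"
      by (intro DERIV_chain2[OF _ tau_deriv[OF tJ], where f = ?v]) (use tJ in simp)
    then show "((\<lambda>s. ?v (\<tau> s)) has_real_derivative W (x t)) (at (x t))"
      using W[OF t] by (simp add: power2_eq_square power3_eq_cube mult_ac)
  qed
  then show ?thesis
    unfolding has_second_deriv_on_def by (intro exI[of _ "\<lambda>s. ?v (\<tau> s)"]) auto
qed

text \<open>The converse is computed directly: for \<open>y = \<rho> Y(x)\<close> the derivative is
  \<open>\<rho>' Y + Y' / \<rho>\<close>, and in the next derivative the two terms with \<open>\<rho>' Y' / \<rho>\<^sup>2\<close> cancel.\<close>

lemma second_deriv_old_variables: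
  assumes Y: "has_second_deriv_on Y W (x ` K)" and K: "K \<subseteq> J"
    and w: "\<And>t. t \<in> K \<Longrightarrow> w t = q t * (\<rho> t * Y (x t)) + W (x t) / (\<rho> t)^3"
  shows "has_second_deriv_on (\<lambda>t. \<rho> t * Y (x t)) w K"
proof -
  obtain Y' where Y: "\<And>t. t \<in> K \<Longrightarrow> (Y has_real_derivative Y' (x t)) (at (x t))"
    and Y': "\<And>t. t \<in> K \<Longrightarrow> (Y' has_real_derivative W (x t)) (at (x t))"
    using Y by (auto simp: has_second_deriv_on_def)
  let ?v = "\<lambda>t. \<rho>' t * Y (x t) + Y' (x t) / \<rho> t"
  have "((\<lambda>t. \<rho> t * Y (x t)) has_real_derivative ?v t) (at t)"
    and "(?v has_real_derivative w t) (at t)" if t: "t \<in> K" for t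
  proof -
    have tJ: "t \<in> J" using t K by auto
    note [derivative_intros] = DERIV_chain2[OF Y[OF t] x_deriv[OF tJ]]
      DERIV_chain2[OF Y'[OF t] x_deriv[OF tJ]]
    show "((\<lambda>t. \<rho> t * Y (x t)) has_real_derivative ?v t) (at t)"
      using rho_deriv[OF tJ] rho_nz[OF tJ]
      by (auto intro!: derivative_eq_intros simp: power2_eq_square field_simps)
    show "(?v has_real_derivative w t) (at t)"
      using rho_deriv[OF tJ] rho'_deriv[OF tJ] rho_nz[OF tJ] w[OF t]
      by (auto intro!: derivative_eq_intros
          simp: power2_eq_square power3_eq_cube field_simps)
  qed
  then show ?thesis unfolding has_second_deriv_on_def by (intro exI[of _ ?v]) auto
qed

lemma Phi_curve:
  assumes "\<And>t. t \<in> K \<Longrightarrow> Y (x t) = y t / \<rho> t" "\<And>t. t \<in> K \<Longrightarrow> Z (x t) = z t / \<rho> t"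
  shows "\<Phi> ` curve K y z = curve (x ` K) Y Z"
  unfolding curve_def image_image by (rule image_cong) (auto simp: \<Phi>_def assms)

text \<open>Substituting \<open>z = \<rho> Z\<close> in the coupling term of \<open>\<rho>\<^sup>3 (y'' - q y) = - \<rho>\<^sup>3 b z\<close> forces the
  coefficient \<open>\<rho>\<^sup>4 b\<close>. Solutions over \<open>K\<close> correspond to solutions over the image of \<open>K\<close> under \<open>x\<close>,
  and every open subinterval of the image of \<open>J\<close> is of this form.\<close>

lemma Phi_transforms_system:
  fixes b :: "real \<Rightarrow> real"
  defines "\<beta> \<equiv> \<lambda>s. (\<rho> (\<tau> s))^4 * b (\<tau> s)"
  shows "transforms_system \<Phi>
      (\<lambda>t y z. q t * y - b t * z) (\<lambda>t y z. b t * y + q t * z) J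
      (\<lambda>x Y Z. - \<beta> x * Z) (\<lambda>x Y Z. \<beta> x * Y) (x ` J)"
  unfolding transforms_system_def
proof (intro conjI allI impI; (elim conjE)?)
  show "point_transformation \<Phi> J (x ` J)" by (rule Phi_point_transformation)
next
  fix K y z
  assume K: "open_interval K" "K \<subseteq> J"
    and sol: "solution_on (\<lambda>t y z. q t * y - b t * z) (\<lambda>t y z. b t * y + q t * z) K y z"
  define Y Z where "Y = (\<lambda>s. y (\<tau> s) / \<rho> (\<tau> s))" and "Z = (\<lambda>s. z (\<tau> s) / \<rho> (\<tau> s))"
  have inK: "\<tau> (x t) = t" "\<rho> t \<noteq> 0" if "t \<in> K" for t using that K rho_nz by auto
  have "has_second_deriv_on Y (\<lambda>s. - \<beta> s * Z s) (x ` K)"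
    unfolding Y_def
    by (rule second_deriv_new_variables[OF _ K(2)])
      (use sol inK in \<open>auto simp: solution_on_def \<beta>_def Z_def power4_eq_xxxx power3_eq_cube\<close>)
  moreover have "has_second_deriv_on Z (\<lambda>s. \<beta> s * Y s) (x ` K)"
    unfolding Z_def
    by (rule second_deriv_new_variables[OF _ K(2)])
      (use sol inK in \<open>auto simp: solution_on_def \<beta>_def Y_def power4_eq_xxxx power3_eq_cube\<close>)
  ultimately have "solution_on (\<lambda>x Y Z. - \<beta> x * Z) (\<lambda>x Y Z. \<beta> x * Y) (x ` K) Y Z"
    by (simp add: solution_on_def)
  moreover have "open_interval (x ` K)"
    using K x_cont x_inj by (blast intro: open_interval_image continuous_on_subset inj_on_subset)
  moreover have "\<Phi> ` curve K y z = curve (x ` K) Y Z"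
    by (rule Phi_curve) (auto simp: Y_def Z_def inK)
  ultimately show "\<exists>K' Y Z. open_interval K' \<and> K' \<subseteq> x ` J \<and>
      solution_on (\<lambda>x Y Z. - \<beta> x * Z) (\<lambda>x Y Z. \<beta> x * Y) K' Y Z \<and>
      \<Phi> ` curve K y z = curve K' Y Z"
    using K by blast
next
  fix K' Y Z
  assume K': "open_interval K'" "K' \<subseteq> x ` J"
    and sol: "solution_on (\<lambda>x Y Z. - \<beta> x * Z) (\<lambda>x Y Z. \<beta> x * Y) K' Y Z"
  define K where "K = \<tau> ` K'"
  have K: "K \<subseteq> J" "x ` K = K'" using K'(2) by (force simp: K_def)+
  have openK: "open_interval K" unfolding K_def
    using K' tau_cont tau_inj
    by (blast intro: open_interval_image continuous_on_subset inj_on_subset)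
  define y z where "y = (\<lambda>t. \<rho> t * Y (x t))" and "z = (\<lambda>t. \<rho> t * Z (x t))"
  have inK: "\<tau> (x t) = t" "\<rho> t \<noteq> 0" if "t \<in> K" for t using that K rho_nz by auto
  have "has_second_deriv_on y (\<lambda>t. q t * y t - b t * z t) K"
    unfolding y_def
    by (rule second_deriv_old_variables[OF _ K(1), where W = "\<lambda>s. - \<beta> s * Z s"])
      (use sol inK K in \<open>auto simp: solution_on_def \<beta>_def z_def power4_eq_xxxx power3_eq_cube\<close>)
  moreover have "has_second_deriv_on z (\<lambda>t. b t * y t + q t * z t) K"
    unfolding z_def
    by (rule second_deriv_old_variables[OF _ K(1), where W = "\<lambda>s. \<beta> s * Y s"])
      (use sol inK K in \<open>auto simp: solution_on_def \<beta>_def y_def power4_eq_xxxx power3_eq_cube\<close>)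
  ultimately have "solution_on (\<lambda>t y z. q t * y - b t * z) (\<lambda>t y z. b t * y + q t * z) K y z"
    by (simp add: solution_on_def)
  moreover have "\<Phi> ` curve K y z = curve K' Y Z"
    unfolding K(2)[symmetric] by (rule Phi_curve) (auto simp: y_def z_def inK)
  ultimately show "\<exists>K y z. open_interval K \<and> K \<subseteq> J \<and>
      solution_on (\<lambda>t y z. q t * y - b t * z) (\<lambda>t y z. b t * y + q t * z) K y z \<and>
      \<Phi> ` curve K y z = curve K' Y Z"
    using K openK by blast
qed

end

text \<open>Continuity of \<open>1 / \<rho>\<^sup>2\<close>, a consequence of \<open>\<rho>\<close> being differentiable without zeros, makes the
  indefinite integral differentiable.\<close>

lemma reduction_data_liouville_change:
  assumes "reduction_data q J \<rho> x"
  obtains \<rho>' where "liouville_change J q \<rho> \<rho>' x"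
proof -
  obtain \<rho>' \<rho>'' a c where J: "open_interval J"
    and \<rho>: "\<And>t. t \<in> J \<Longrightarrow> (\<rho> has_real_derivative \<rho>' t) (at t)"
    and \<rho>': "\<And>t. t \<in> J \<Longrightarrow> (\<rho>' has_real_derivative \<rho>'' t) (at t)"
    and eq: "\<And>t. t \<in> J \<Longrightarrow> \<rho>'' t - q t * \<rho> t = 0"
    and nz: "\<And>t. t \<in> J \<Longrightarrow> \<rho> t \<noteq> 0"
    and a: "a \<in> J" and x: "\<And>t. t \<in> J \<Longrightarrow> x t = c + (LBINT s=ereal a..ereal t. 1 / (\<rho> s)\<^sup>2)"
    using assms unfolding reduction_data_def has_second_deriv_on_def indefinite_integral_on_def
    by metis
  have "continuous_on J \<rho>"
    by (rule continuous_at_imp_continuous_on) (auto dest: \<rho> DERIV_isCont)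
  then have cont: "continuous_on J (\<lambda>s. 1 / (\<rho> s)\<^sup>2)"
    by (intro continuous_intros) (auto simp: nz)
  have "(x has_real_derivative 1 / (\<rho> t)\<^sup>2) (at t)" if t: "t \<in> J" for t
  proof -
    have "((\<lambda>t. c + (LBINT s=ereal a..ereal t. 1 / (\<rho> s)\<^sup>2)) has_real_derivative 1 / (\<rho> t)\<^sup>2) (at t)"
      using DERIV_add[OF DERIV_const interval_primitive_has_derivative[OF J cont a t]] by simp
    moreover have "open J" using J by (simp add: open_interval_def)
    ultimately show ?thesis
      by (rule has_field_derivative_transform_within_open) (use t x in auto)
  qed
  then have "liouville_change J q \<rho> \<rho>' x"
    using J \<rho> \<rho>' eq nz by unfold_locales auto
  then show ?thesis by (rule that)
qed

section \<open>Local existence of a nonvanishing solution of the scalar equation\<close>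

text \<open>The terms of the Picard series; its partial sums are the successive approximations to the
  solution of \<open>\<rho>'' = q \<rho>\<close> with \<open>\<rho> a = 1\<close> and \<open>\<rho>' a = 0\<close>.\<close>

primrec picard_term :: "(real \<Rightarrow> real) \<Rightarrow> real \<Rightarrow> nat \<Rightarrow> real \<Rightarrow> real" where
  "picard_term q a 0 = (\<lambda>t. 1)"
| "picard_term q a (Suc n) =
     (\<lambda>t. LBINT s=ereal a..ereal t. (LBINT r=ereal a..ereal s. q r * picard_term q a n r))"

text \<open>The inner integral in the term with index \<open>n + 1\<close>, hence the derivative of that term.\<close>

abbreviation picard_slope :: "(real \<Rightarrow> real) \<Rightarrow> real \<Rightarrow> nat \<Rightarrow> real \<Rightarrow> real" where
  "picard_slope q a n \<equiv> \<lambda>s. LBINT r=ereal a..ereal s. q r * picard_term q a n r"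

text \<open>On an interval of radius \<open>\<delta> \<le> 1\<close> with \<open>M \<delta> \<le> 1/4\<close> each double integration shrinks the
  supremum by a factor of at least 4: the inner integral yields \<open>M \<delta>\<close>, the outer one \<open>\<delta>\<close>.
  The series of terms, of slopes and of second derivatives therefore converge uniformly and may be
  differentiated term by term. The terms with positive index sum to at most
  \<open>1/4 + 1/16 + \<dots> = 1/3\<close> in absolute value, which keeps the solution away from zero.\<close>

lemma small_interval_nonvanishing_solution:
  assumes \<delta>: "0 < \<delta>" "\<delta> \<le> 1" and q: "continuous_on (ball a \<delta>) q"
    and M: "\<And>t. t \<in> ball a \<delta> \<Longrightarrow> \<bar>q t\<bar> \<le> M" "M * \<delta> \<le> 1/4"
  obtains \<rho> where "has_second_deriv_on \<rho> (\<lambda>t. q t * \<rho> t) (ball a \<delta>)"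
    and "\<And>t. t \<in> ball a \<delta> \<Longrightarrow> \<rho> t \<noteq> 0"
proof -
  let ?B = "ball a \<delta>"
  let ?\<phi> = "picard_term q a" and ?\<psi> = "picard_slope q a"
  have J: "open_interval ?B"
    using \<delta> by (auto simp: open_interval_def is_interval_ball_real)
  have a: "a \<in> ?B" using \<delta> by simp
  have within: "at t within ?B = at t" if "t \<in> ?B" for t
    using that by (rule at_within_open) simp
  have M0: "M \<ge> 0" using M(1)[OF a] by linarith
  have cont\<phi>: "continuous_on ?B (?\<phi> n)"
    and d\<psi>: "\<And>t. t \<in> ?B \<Longrightarrow> (?\<psi> n has_real_derivative q t * ?\<phi> n t) (at t)"
    and cont\<psi>: "continuous_on ?B (?\<psi> n)" for n
  proof -
    have step: "(\<forall>t\<in>?B. (?\<psi> n has_real_derivative q t * ?\<phi> n t) (at t)) \<and> continuous_on ?B (?\<psi> n)"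
      if "continuous_on ?B (?\<phi> n)" for n
    proof -
      have *: "(?\<psi> n has_real_derivative q t * ?\<phi> n t) (at t)" if "t \<in> ?B" for t
        by (rule interval_primitive_has_derivative[OF J _ a that])
          (intro continuous_on_mult q \<open>continuous_on ?B (?\<phi> n)\<close>)
      then show ?thesis by (meson DERIV_isCont continuous_at_imp_continuous_on)
    qed
    show c: "continuous_on ?B (?\<phi> n)"
    proof (induction n)
      case (Suc n)
      then have "(?\<phi> (Suc n) has_real_derivative ?\<psi> n t) (at t)" if "t \<in> ?B" for t
        using interval_primitive_has_derivative[OF J conjunct2[OF step] a that] by simp
      then show ?case by (meson DERIV_isCont continuous_at_imp_continuous_on)
    qed simp
    show "(?\<psi> n has_real_derivative q t * ?\<phi> n t) (at t)" if "t \<in> ?B" for t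
      using step[OF c] that by blast
    show "continuous_on ?B (?\<psi> n)" using step[OF c] by blast
  qed
  have d\<phi>: "(?\<phi> (Suc n) has_real_derivative ?\<psi> n t) (at t)" if "t \<in> ?B" for n t
    using interval_primitive_has_derivative[OF J cont\<psi> a that] by simp
  have bound_step: "\<bar>?\<psi> n t\<bar> \<le> (1/4)^Suc n"
    if "\<And>t. t \<in> ?B \<Longrightarrow> \<bar>?\<phi> n t\<bar> \<le> (1/4)^n" and t: "t \<in> ?B" for n t
  proof -
    have "\<bar>?\<psi> n t\<bar> \<le> (M * (1/4)^n) * \<bar>t - a\<bar>"
      by (rule interval_primitive_bound[OF J _ a t])
        (use that M M0 in \<open>auto intro!: continuous_on_mult q cont\<phi> mult_mono simp: abs_mult\<close>)
    also have "\<dots> \<le> (M * (1/4)^n) * \<delta>"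
      using t M0 by (intro mult_left_mono) (auto simp: dist_real_def)
    also have "\<dots> = (1/4)^n * (M * \<delta>)" by simp
    also have "\<dots> \<le> (1/4)^n * (1/4)" using M(2) by (intro mult_left_mono) auto
    finally show ?thesis by simp
  qed
  have bound\<phi>: "\<bar>?\<phi> n t\<bar> \<le> (1/4)^n" if "t \<in> ?B" for n t
    using that
  proof (induction n arbitrary: t)
    case (Suc n)
    have "\<bar>?\<phi> (Suc n) t\<bar> \<le> (1/4)^Suc n * \<bar>t - a\<bar>"
      using interval_primitive_bound[OF J cont\<psi> a Suc.prems bound_step] Suc.IH by simp
    also have "\<dots> \<le> (1/4)^Suc n * 1"
      using Suc.prems \<delta> by (intro mult_left_mono) (auto simp: dist_real_def)
    finally show ?case by simp
  qed simp
  have bound\<psi>: "\<bar>?\<psi> n t\<bar> \<le> (1/4)^Suc n" if "t \<in> ?B" for n t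
    using bound_step bound\<phi> that by blast
  have geo: "(\<lambda>n. (1/4::real)^Suc n) sums (1/3)"
    using sums_mult[OF geometric_sums[of "1/4::real"], of "1/4"] by simp
  have sum\<phi>: "summable (\<lambda>n. ?\<phi> (Suc n) t)" if "t \<in> ?B" for t
    by (rule summable_comparison_test'[OF sums_summable[OF geo]])
      (use bound\<phi>[OF that, of "Suc _"] in \<open>auto simp del: picard_term.simps power_Suc\<close>)
  have sum\<psi>: "summable (\<lambda>n. ?\<psi> n t)" if "t \<in> ?B" for t
    by (rule summable_comparison_test'[OF sums_summable[OF geo]]) (use bound\<psi>[OF that] in auto)
  \<comment> \<open>The constant leading term is split off: its slope is not of the form \<open>?\<psi> n\<close>,
    so \<open>r\<close> is the solution minus 1 and \<open>\<sigma>\<close> its derivative.\<close>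
  define r where "r t = (\<Sum>n. ?\<phi> (Suc n) t)" for t
  define \<sigma> where "\<sigma> t = (\<Sum>n. ?\<psi> n t)" for t
  have r_le: "\<bar>r t\<bar> \<le> 1/3" if "t \<in> ?B" for t
    unfolding r_def sums_unique[OF geo] real_norm_def[symmetric]
    by (rule norm_suminf_le[OF _ sums_summable[OF geo]])
      (use bound\<phi>[OF that, of "Suc _"] in \<open>auto simp del: picard_term.simps power_Suc\<close>)
  have q\<phi>: "(\<Sum>n. q t * ?\<phi> n t) = q t * (1 + r t)" if "t \<in> ?B" for t
  proof -
    have "summable (\<lambda>n. ?\<phi> n t)" using sum\<phi>[OF that] summable_Suc_iff by blast
    then show ?thesis
      using suminf_split_head[of "\<lambda>n. ?\<phi> n t"] suminf_mult[of "\<lambda>n. ?\<phi> n t" "q t"]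
      by (simp add: r_def del: picard_term.simps(2))
  qed
  have r_deriv: "(r has_real_derivative \<sigma> t) (at t)" if t: "t \<in> ?B" for t
  proof -
    have uc: "uniformly_convergent_on ?B (\<lambda>n t. \<Sum>i<n. ?\<psi> i t)"
      by (rule Weierstrass_m_test'[OF _ sums_summable[OF geo]]) (use bound\<psi> in auto)
    show ?thesis
      unfolding r_def \<sigma>_def
      by (rule has_field_derivative_series'(2)[where S = ?B and ?x0.0 = a
            and f = "\<lambda>n. ?\<phi> (Suc n)"])
        (use uc t a d\<phi> sum\<phi> in \<open>auto simp: within simp del: picard_term.simps\<close>)
  qed
  have \<sigma>_deriv: "(\<sigma> has_real_derivative q t * (1 + r t)) (at t)" if t: "t \<in> ?B" for t
  proof -
    have uc: "uniformly_convergent_on ?B (\<lambda>n t. \<Sum>i<n. q t * ?\<phi> i t)"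
    proof (rule Weierstrass_m_test')
      show "norm (q t * ?\<phi> n t) \<le> M * (1/4)^n" if "t \<in> ?B" for n t
        using bound\<phi>[OF that] M(1)[OF that] M0 by (auto intro!: mult_mono simp: abs_mult)
      show "summable (\<lambda>n. M * (1/4)^n)" by (intro summable_mult summable_geometric) simp
    qed
    have "(\<sigma> has_real_derivative (\<Sum>n. q t * ?\<phi> n t)) (at t)"
      unfolding \<sigma>_def
      by (rule has_field_derivative_series'(2)[where S = ?B and ?x0.0 = a and f = ?\<psi>])
        (use uc t a d\<psi> sum\<psi> in \<open>auto simp: within\<close>)
    then show ?thesis using q\<phi>[OF t] by simp
  qed
  show ?thesis
  proof (rule that[of "\<lambda>t. 1 + r t"])
    show "has_second_deriv_on (\<lambda>t. 1 + r t) (\<lambda>t. q t * (1 + r t)) ?B"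
      unfolding has_second_deriv_on_def
      using DERIV_add[OF DERIV_const r_deriv] \<sigma>_deriv by (intro exI[of _ \<sigma>]) auto
    show "1 + r t \<noteq> 0" if "t \<in> ?B" for t using r_le[OF that] by auto
  qed
qed

text \<open>Near \<open>t0\<close> a continuous coefficient is bounded, so a sufficiently small ball meets the
  smallness condition of the series solution; the integral for \<open>x\<close> is based at \<open>t0\<close>.\<close>

lemma reduction_data_exists:
  assumes I: "open_interval I" and q: "continuous_on I q" and t0: "t0 \<in> I"
  obtains J \<rho> x where "t0 \<in> J" "J \<subseteq> I" "reduction_data q J \<rho> x"
proof -
  obtain e where e: "e > 0" "cball t0 e \<subseteq> I"
    using I t0 open_contains_cball unfolding open_interval_def by blast
  have "bounded (q ` cball t0 e)"
    using compact_continuous_image[OF continuous_on_subset[OF q e(2)] compact_cball]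
    by (rule compact_imp_bounded)
  then obtain M where M: "M > 0" "\<And>t. t \<in> cball t0 e \<Longrightarrow> \<bar>q t\<bar> \<le> M"
    by (auto simp: bounded_pos)
  define \<delta> where "\<delta> = min (min e 1) (1 / (4 * M))"
  have \<delta>: "0 < \<delta>" "\<delta> \<le> 1" "\<delta> \<le> e" "\<delta> \<le> 1 / (4 * M)" using e M by (auto simp: \<delta>_def)
  have sub: "ball t0 \<delta> \<subseteq> cball t0 e" using \<delta>(3) by auto
  have "M * \<delta> \<le> 1/4" using mult_left_mono[OF \<delta>(4), of M] M(1) by simp
  then obtain \<rho> where \<rho>: "has_second_deriv_on \<rho> (\<lambda>t. q t * \<rho> t) (ball t0 \<delta>)"
    "\<And>t. t \<in> ball t0 \<delta> \<Longrightarrow> \<rho> t \<noteq> 0"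
    using small_interval_nonvanishing_solution[OF \<delta>(1,2), of t0 q M] sub e(2) M(2)
      continuous_on_subset[OF q, of "ball t0 \<delta>"] by blast
  have "reduction_data q (ball t0 \<delta>) \<rho> (\<lambda>t. 0 + (LBINT s=ereal t0..ereal t. 1 / (\<rho> s)\<^sup>2))"
    unfolding reduction_data_def indefinite_integral_on_def
  proof (intro conjI)
    show "open_interval (ball t0 \<delta>)"
      using \<delta> by (auto simp: open_interval_def is_interval_ball_real)
    show "\<exists>\<rho>''. has_second_deriv_on \<rho> \<rho>'' (ball t0 \<delta>) \<and>
        (\<forall>t\<in>ball t0 \<delta>. \<rho>'' t - q t * \<rho> t = 0)"
      using \<rho>(1) by auto
    show "\<forall>t\<in>ball t0 \<delta>. \<rho> t \<noteq> 0" using \<rho>(2) by blast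
    show "\<exists>a\<in>ball t0 \<delta>. \<exists>c. \<forall>t\<in>ball t0 \<delta>.
        0 + (LBINT s=ereal t0..ereal t. 1 / (\<rho> s)\<^sup>2) =
        c + (LBINT s=ereal a..ereal t. 1 / (\<rho> s)\<^sup>2)"
      using \<delta>(1) by (intro bexI[of _ t0] exI[of _ 0]) auto
  qed
  then show ?thesis using that \<delta>(1) sub e(2) by (metis centre_in_ball order_trans)
qed

theorem theorem4:
  fixes \<alpha>\<^sub>3 \<alpha>\<^sub>4 :: "real \<Rightarrow> real" and I :: "real set"
  assumes "open_interval I"
  shows "(\<forall>J \<rho> x. J \<subseteq> I \<and> reduction_data \<alpha>\<^sub>3 J \<rho> x \<longrightarrow>
            (\<exists>\<beta> :: real \<Rightarrow> real.
               transforms_system (\<lambda>(t, y, z). (x t, y / \<rho> t, z / \<rho> t))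
                 (\<lambda>t y z. \<alpha>\<^sub>3 t * y - \<alpha>\<^sub>4 t * z) (\<lambda>t y z. \<alpha>\<^sub>4 t * y + \<alpha>\<^sub>3 t * z) J
                 (\<lambda>x Y Z. - \<beta> x * Z) (\<lambda>x Y Z. \<beta> x * Y) (x ` J)))
       \<and> (continuous_on I \<alpha>\<^sub>3 \<longrightarrow>
            (\<forall>t\<^sub>0\<in>I. \<exists>J \<rho> x. t\<^sub>0 \<in> J \<and> J \<subseteq> I \<and> reduction_data \<alpha>\<^sub>3 J \<rho> x))"
proof (intro conjI allI impI ballI)
  fix J \<rho> x assume "J \<subseteq> I \<and> reduction_data \<alpha>\<^sub>3 J \<rho> x"
  then obtain \<rho>' where "liouville_change J \<alpha>\<^sub>3 \<rho> \<rho>' x"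
    using reduction_data_liouville_change by blast
  then interpret liouville_change J \<alpha>\<^sub>3 \<rho> \<rho>' x .
  show "\<exists>\<beta> :: real \<Rightarrow> real.
      transforms_system (\<lambda>(t, y, z). (x t, y / \<rho> t, z / \<rho> t))
        (\<lambda>t y z. \<alpha>\<^sub>3 t * y - \<alpha>\<^sub>4 t * z) (\<lambda>t y z. \<alpha>\<^sub>4 t * y + \<alpha>\<^sub>3 t * z) J
        (\<lambda>x Y Z. - \<beta> x * Z) (\<lambda>x Y Z. \<beta> x * Y) (x ` J)"
    using Phi_transforms_system[of \<alpha>\<^sub>4] unfolding \<Phi>_def
    by (intro exI[of _ "\<lambda>s. (\<rho> (\<tau> s))^4 * \<alpha>\<^sub>4 (\<tau> s)"])
next
  fix t\<^sub>0 assume "continuous_on I \<alpha>\<^sub>3" "t\<^sub>0 \<in> I"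
  then show "\<exists>J \<rho> x. t\<^sub>0 \<in> J \<and> J \<subseteq> I \<and> reduction_data \<alpha>\<^sub>3 J \<rho> x"
    using reduction_data_exists[OF assms] by metis
qed

end
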